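(* Let $X$ be a Banach space satisfying the following property: (i) there exists $A\subseteq S_X$ such that the absolute convex hull of $A$ is dense in the unit ball of $X$; (ii) for every $\varepsilon >0$ small enough, there exists $\varpi_X(\varepsilon) >0$ such that for every $x\in A$ there exists $x^*_{x,\varepsilon} \in B_{X^*}$ with $$\forall z\in A: \quad \|z-x\|\geq \varepsilon \Longrightarrow x^*_{x,\varepsilon}(x) -\varpi_X(\varepsilon) \geq |x^*_{x,\varepsilon}(z)|.$$ Then, for every Banach space $W$ and for any closed subspace $\mathcal{A}$ of $\mathcal{L}(X,W)$ containing the space $\mathcal{F}(X,W)$ of finite rank operators, we have: for every $S \in \mathcal{L}(X,W)$ the set $$\mathcal{G}(S):=\{ T \in \mathcal{A} : S+T \text{ attains strongly its norm on } A \}$$ is the complement of a $\sigma$-porous subset of $\mathcal{A}$. Moreover, the following version of the Bishop–Phelps–Bollobás theorem holds: given $\varepsilon >0$, there exists $\eta(\varepsilon)>0$ such that whenever $T\in \mathcal{A}$ with $\|T\|=1$ and $x\in A$ satisfy $\|T(x)\|>1-\eta(\varepsilon)$, there are $S \in \mathcal{A}$ with $\|S\|=1$ and $z \in A$ such that $$\|S(z)\|=1, \quad \|x-z\| < \varepsilon \quad\text{and}\quad \|S-T\|<\varepsilon.$$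
   Context: All Banach spaces are real. $S_X$ is the unit sphere of $X$, and $B_{X^*}$ is the closed unit ball of the topological dual $X^*$. $\mathcal{L}(X,W)$ is the space of bounded linear operators from $X$ to $W$ with the operator norm, and $\mathcal{F}(X,W)$ is its subspace of finite rank operators. An operator $T\in\mathcal{L}(X,W)$ attains strongly its norm on a subset $A\subseteq S_X$ if $\|T\|=\sup\{\|T(x)\|:x\in A\}$ and there is $x_0\in A$ such that the map $x\mapsto\|T(x)\|$ attains strongly its maximum on $A$ at $x_0$, i.e. $\|T(x_0)\|=\sup_{x\in A}\|T(x)\|$ and $\|x_n-x_0\|\to0$ whenever $(x_n)\subseteq A$ and $\|T(x_n)\|\to\|T(x_0)\|$. "For every $\varepsilon>0$ small enough" means for all $\varepsilon\in(0,\varepsilon_0)$ for some $\varepsilon_0>0$. A subset $P$ of a metric space $(M,d)$ is porous if there exist $\lambda_0\in(0,1]$ and $r_0>0$ such that for any $x\in M$ and $r\in(0,r_0]$ there is $y\in M$ with $\mathring{B}(y;\lambda_0 r)\subseteq \mathring{B}(x;r)\cap (M\setminus P)$, where $\mathring{B}(x;r)$ is the open ball of centre $x$ and radius $r$. A set is $\sigma$-porous if it is a countable union of porous sets.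
   Formalization: The set A is additionally assumed closed and W is assumed nonzero; without closedness of A both conclusions can fail, and for W = {0} the porosity claim fails when A has at least two points. *)

theory Defs
  imports "HOL-Analysis.Analysis"
begin

definition absolutely_convex :: "'a::real_vector set \<Rightarrow> bool" where
  "absolutely_convex C \<longleftrightarrow>
     convex C \<and> (\<forall>c x. \<bar>c\<bar> \<le> 1 \<longrightarrow> x \<in> C \<longrightarrow> c *\<^sub>R x \<in> C)"

text \<open>The empty set is its own absolutely convex hull. Hence a set \<open>A\<close> of unit vectors whose
  hull is dense in the unit ball is nonempty, and the space is nonzero.\<close>

definition absolutely_convex_hull :: "'a::real_vector set \<Rightarrow> 'a set" where
  "absolutely_convex_hull A = absolutely_convex hull A"

definition finite_rank_ops :: "('a::real_normed_vector \<Rightarrow>\<^sub>L 'b::real_normed_vector) set" where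
  "finite_rank_ops = {T. \<exists>B. finite B \<and> range (blinfun_apply T) \<subseteq> span B}"

text \<open>Meant for bounded \<open>A\<close>, where both suprema are suprema of bounded sets.\<close>

definition attains_strongly_norm_on ::
    "('a::real_normed_vector \<Rightarrow>\<^sub>L 'b::real_normed_vector) \<Rightarrow> 'a set \<Rightarrow> bool" where
  "attains_strongly_norm_on T A \<longleftrightarrow>
     norm T = (SUP x\<in>A. norm (blinfun_apply T x)) \<and>
     (\<exists>x0\<in>A. norm (blinfun_apply T x0) = (SUP x\<in>A. norm (blinfun_apply T x)) \<and>
        (\<forall>x :: nat \<Rightarrow> 'a. (\<forall>n. x n \<in> A) \<longrightarrow>
           (\<lambda>n. norm (blinfun_apply T (x n))) \<longlonglongrightarrow> norm (blinfun_apply T x0) \<longrightarrow>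
           (\<lambda>n. norm (x n - x0)) \<longlonglongrightarrow> 0))"

text \<open>Porosity in the metric space \<open>M\<close>, a subset of the ambient type with the induced metric.
  The open ball of \<open>M\<close> with centre \<open>y\<close> and radius \<open>s\<close> is \<open>ball y s \<inter> M\<close>.\<close>

definition porous_in :: "'a::metric_space set \<Rightarrow> 'a set \<Rightarrow> bool" where
  "porous_in M P \<longleftrightarrow> P \<subseteq> M \<and>
     (\<exists>l0 r0 :: real. 0 < l0 \<and> l0 \<le> 1 \<and> 0 < r0 \<and>
        (\<forall>x\<in>M. \<forall>r. 0 < r \<and> r \<le> r0 \<longrightarrow>
           (\<exists>y\<in>M. ball y (l0 * r) \<inter> M \<subseteq> (ball x r \<inter> M) \<inter> (M - P))))"

definition sigma_porous_in :: "'a::metric_space set \<Rightarrow> 'a set \<Rightarrow> bool" where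
  "sigma_porous_in M P \<longleftrightarrow>
     (\<exists>Q :: nat \<Rightarrow> 'a set. (\<forall>n. porous_in M (Q n)) \<and> P = (\<Union>n. Q n))"

end

theory Submission
  imports Defs
begin

text \<open>
  Fix an operator \<open>U = S + T\<close> and look at the sets of near maximizers
  \<open>{z \<in> A. \<parallel>U\<parallel> - s < \<parallel>U z\<parallel>}\<close>. Density of the absolutely convex hull makes \<open>A\<close> norming for
  every operator, so these sets are nonempty for \<open>s > 0\<close>. If they shrink to diameter zero as
  \<open>s\<close> decreases to \<open>0\<close>, then every maximizing sequence is Cauchy, and as \<open>A\<close> is closed in a Banach
  space, \<open>U\<close> attains its norm strongly (\<open>strongly_attaining_if_localized\<close>). It therefore suffices
  to show, for arbitrarily small \<open>\<epsilon>\<close>, that the operators with no set of near maximizers (\<open>s > 0\<close>)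
  inside an \<open>\<epsilon>\<close>-ball form a porous set; a sequence of such \<open>\<epsilon>\<close> tending to \<open>0\<close> gives the countable
  union.

  The key is a rank one perturbation (\<open>rank_one_bump\<close>). Pick \<open>x \<in> A\<close> at which \<open>U\<close> almost attains
  its norm, let \<open>w\<close> be a unit vector with \<open>U x = \<parallel>U x\<parallel> w\<close>, and let \<open>f\<close> be the functional that
  exposes \<open>x\<close> up to \<open>\<epsilon>\<close> with gap \<open>\<omega>\<close>. Adding \<open>\<rho> (f \<otimes> w)\<close> lifts the value at \<open>x\<close> by the full
  amount \<open>\<rho> f(x)\<close>, since \<open>w\<close> is aligned with \<open>U x\<close>, but lifts the value at points at distance
  \<open>\<ge> \<epsilon>\<close> by at most \<open>\<rho> (f(x) - \<omega>)\<close>. So all near maximizers of the new operator up to tolerance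
  about \<open>\<rho> \<omega>\<close> lie close to \<open>x\<close>. This survives perturbations of size a fixed fraction of \<open>\<rho> \<omega>\<close>
  (\<open>near_maximizers_stable\<close>), and as \<open>\<omega>\<close> depends only on \<open>\<epsilon>\<close>, that is porosity.

  For the Bishop--Phelps--Bollobas part the same bump is applied at the given point \<open>x\<close>. It traps
  all near maximizers near \<open>x\<close>; the Baire category theorem provides a strongly attaining operator
  extremely close to the bumped one, its maximizer is trapped too, and normalizing finishes.
\<close>

section \<open>Porous sets\<close>

lemma porous_in_subset:
  assumes "porous_in M P" "Q \<subseteq> P"
  shows "porous_in M Q"
  using assms unfolding porous_in_def by (meson Diff_mono Int_mono order_refl order_trans)

text \<open>Every ball contains a smaller ball that misses \<open>P\<close>, so the union of all balls missing \<open>P\<close> is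
  dense: a porous set is nowhere dense.\<close>

lemma porous_in_avoids_dense_open:
  assumes "porous_in M P"
  obtains G where "openin (top_of_set M) G" "M \<subseteq> closure G" "G \<subseteq> M - P"
proof -
  from assms obtain l r0 :: real where l: "0 < l" "0 < r0"
    and hole: "\<And>x r. x \<in> M \<Longrightarrow> 0 < r \<Longrightarrow> r \<le> r0 \<Longrightarrow>
      \<exists>y\<in>M. ball y (l * r) \<inter> M \<subseteq> (ball x r \<inter> M) \<inter> (M - P)"
    unfolding porous_in_def by blast
  define G where "G = M \<inter> \<Union>{ball y s | y s. ball y s \<inter> M \<subseteq> M - P}"
  have "openin (top_of_set M) G"
    unfolding G_def by (intro openin_open_Int open_Union) auto
  moreover have "G \<subseteq> M - P"
    unfolding G_def by blast
  moreover have "M \<subseteq> closure G"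
  proof
    fix x assume x: "x \<in> M"
    show "x \<in> closure G"
      unfolding closure_approachable
    proof (intro allI impI)
      fix e :: real assume "0 < e"
      then obtain y where y: "y \<in> M"
        "ball y (l * min e r0) \<inter> M \<subseteq> (ball x (min e r0) \<inter> M) \<inter> (M - P)"
        using hole[OF x, of "min e r0"] l by auto
      have yb: "y \<in> ball y (l * min e r0)"
        using l \<open>0 < e\<close> by simp
      with y have "y \<in> G"
        unfolding G_def by blast
      moreover have "dist y x < e"
        using y(1) yb subsetD[OF y(2), of y] by (simp add: dist_commute)
      ultimately show "\<exists>y\<in>G. dist y x < e" by blast
    qed
  qed
  ultimately show thesis using that by blast
qed

text \<open>This is where the Baire category theorem enters.\<close>

lemma sigma_porous_in_codense:
  fixes M :: "'a::complete_space set"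
  assumes "closed M" "sigma_porous_in M P"
  shows "M \<subseteq> closure (M - P)"
proof -
  from assms(2) obtain Q :: "nat \<Rightarrow> 'a set"
    where Q: "\<And>n. porous_in M (Q n)" "P = (\<Union>n. Q n)"
    unfolding sigma_porous_in_def by blast
  have "\<exists>G. openin (top_of_set M) G \<and> M \<subseteq> closure G \<and> G \<subseteq> M - Q n" for n
    using porous_in_avoids_dense_open[OF Q(1)] by metis
  then obtain G where G: "\<And>n. openin (top_of_set M) (G n)" "\<And>n. M \<subseteq> closure (G n)"
    "\<And>n. G n \<subseteq> M - Q n"
    by metis
  then have G_sub: "M \<inter> G n = G n" for n by blast
  have "completely_metrizable_space (top_of_set M)"
    using assms(1) completely_metrizable_space_closedin completely_metrizable_space_euclidean
    by (metis closed_closedin)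
  then have "(top_of_set M) closure_of (\<Inter>(range G)) = topspace (top_of_set M)"
    using G(1) subsetD[OF G(2)]
    by (intro Baire_category) (auto simp: closure_of_subtopology Int_absorb1 G_sub)
  then have "M \<subseteq> closure (\<Inter>(range G))"
    by (auto simp: closure_of_subtopology dest: closure_mono[THEN subsetD, rotated])
  also have "\<dots> \<subseteq> closure (M - P)"
    using G(3) Q(2) by (intro closure_mono) blast
  finally show ?thesis .
qed

section \<open>Near maximizers of an operator\<close>

definition near_maximizers ::
    "('a::real_normed_vector \<Rightarrow>\<^sub>L 'b::real_normed_vector) \<Rightarrow> 'a set \<Rightarrow> real \<Rightarrow> 'a set" where
  "near_maximizers U A s = {z \<in> A. norm U - s < norm (blinfun_apply U z)}"

definition maximizers_localized ::
    "('a::real_normed_vector \<Rightarrow>\<^sub>L 'b::real_normed_vector) \<Rightarrow> 'a set \<Rightarrow> real \<Rightarrow> bool" where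
  "maximizers_localized U A \<epsilon> \<longleftrightarrow> (\<exists>s>0. \<exists>x. near_maximizers U A s \<subseteq> ball x \<epsilon>)"

lemma maximizers_localized_mono:
  "maximizers_localized U A d \<Longrightarrow> d \<le> e \<Longrightarrow> maximizers_localized U A e"
  unfolding maximizers_localized_def by (meson order_trans subset_ball)

lemma norm_apply_le_norm:
  assumes "A \<subseteq> sphere 0 1" "z \<in> A"
  shows "norm (blinfun_apply U z) \<le> norm U"
  using norm_blinfun[of U z] assms by auto

text \<open>Replacing \<open>V\<close> by \<open>V'\<close> costs \<open>\<parallel>V' - V\<parallel>\<close> twice: once in the norm of the operator and once in
  its value at the point.\<close>

lemma near_maximizers_stable:
  assumes "A \<subseteq> sphere 0 1" "s + 2 * norm (V' - V) \<le> t"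
  shows "near_maximizers V' A s \<subseteq> near_maximizers V A t"
proof
  fix z assume z: "z \<in> near_maximizers V' A s"
  then have "z \<in> A" by (simp add: near_maximizers_def)
  have "norm (V' z) \<le> norm (V z) + norm ((V' - V) z)"
    using norm_triangle_ineq[of "V z" "(V' - V) z"] by (simp add: blinfun.diff_left)
  also have "\<dots> \<le> norm (V z) + norm (V' - V)"
    using norm_apply_le_norm[OF assms(1) \<open>z \<in> A\<close>] by simp
  finally have "norm (V' z) \<le> norm (V z) + norm (V' - V)" .
  moreover have "norm V \<le> norm V' + norm (V' - V)"
    using norm_triangle_ineq2[of V V'] by (simp add: norm_minus_commute)
  ultimately show "z \<in> near_maximizers V A t"
    using z assms(2) by (simp add: near_maximizers_def)
qed

section \<open>Norming sets\<close>

lemma nonempty_if_hull_dense: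
  assumes "closure (absolutely_convex_hull A) = cball 0 1"
  shows "A \<noteq> {}"
proof
  assume "A = {}"
  moreover have "absolutely_convex ({} :: 'a set)"
    by (simp add: absolutely_convex_def)
  ultimately have "absolutely_convex_hull A = {}"
    by (simp add: absolutely_convex_hull_def hull_same)
  with assms have "cball (0::'a) 1 = {}" by simp
  then show False by (simp only: cball_eq_empty)
qed

text \<open>The set of points at which \<open>\<parallel>U x\<parallel> \<le> b\<close> is closed and absolutely convex; once it contains
  \<open>A\<close>, it contains the whole unit ball.\<close>

lemma norm_le_if_bounded_on_norming:
  assumes dense: "closure (absolutely_convex_hull A) = cball 0 1"
    and bound: "\<And>x. x \<in> A \<Longrightarrow> norm (blinfun_apply U x) \<le> b"
  shows "norm U \<le> b"
proof -
  obtain a where "a \<in> A"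
    using nonempty_if_hull_dense[OF dense] by blast
  then have "0 \<le> b"
    using bound[of a] norm_ge_zero order_trans by blast
  define C where "C = {x. norm (blinfun_apply U x) \<le> b}"
  have vim: "C = blinfun_apply U -` cball 0 b"
    by (auto simp: C_def)
  have "closed C"
    unfolding C_def by (intro closed_Collect_le continuous_intros)
  have "convex C"
    unfolding vim by (intro convex_linear_vimage bounded_linear.linear
        blinfun.bounded_linear_right convex_cball)
  moreover have "c *\<^sub>R x \<in> C" if "\<bar>c\<bar> \<le> 1" "x \<in> C" for c x
    using mult_mono[OF that(1), of "norm (U x)" b] that(2) by (simp add: C_def blinfun.scaleR_right)
  ultimately have "absolutely_convex C"
    by (simp add: absolutely_convex_def)
  then have "absolutely_convex_hull A \<subseteq> C"
    unfolding absolutely_convex_hull_def using bound by (intro hull_minimal) (auto simp: C_def)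
  then have ball: "cball 0 1 \<subseteq> C"
    using closure_minimal[OF _ \<open>closed C\<close>] dense by metis
  show ?thesis
  proof (rule norm_blinfun_bound[OF \<open>0 \<le> b\<close>])
    fix x
    show "norm (U x) \<le> b * norm x"
    proof (cases "x = 0")
      case False
      then have "x /\<^sub>R norm x \<in> C"
        using ball by (intro subsetD[OF ball]) simp
      then show ?thesis
        using False by (simp add: C_def blinfun.scaleR_right divide_simps mult.commute)
    qed simp
  qed
qed

lemma near_maximizers_nonempty:
  assumes "closure (absolutely_convex_hull A) = cball 0 1" "s > 0"
  shows "near_maximizers U A s \<noteq> {}"
proof
  assume "near_maximizers U A s = {}"
  then have "norm U \<le> norm U - s"
    by (intro norm_le_if_bounded_on_norming[OF assms(1)]) (force simp: near_maximizers_def)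
  with assms(2) show False by simp
qed

lemma norm_eq_SUP_norming:
  assumes sphere: "A \<subseteq> sphere 0 1"
    and dense: "closure (absolutely_convex_hull A) = cball 0 1"
  shows "norm U = (SUP x\<in>A. norm (blinfun_apply U x))"
proof (rule antisym)
  have "bdd_above ((\<lambda>x. norm (U x)) ` A)"
    using norm_apply_le_norm[OF sphere] by (intro bdd_aboveI2) blast
  then show "norm U \<le> (SUP x\<in>A. norm (U x))"
    by (intro norm_le_if_bounded_on_norming[OF dense] cSUP_upper)
  show "(SUP x\<in>A. norm (U x)) \<le> norm U"
    using nonempty_if_hull_dense[OF dense] norm_apply_le_norm[OF sphere] by (intro cSUP_least)
qed

text \<open>Localization at every scale says that the sets of near maximizers have diameters tending to
  zero. This is the Cantor intersection argument: a maximizing sequence is Cauchy, its limit is a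
  maximizer, and every other maximizing sequence is driven to the same point.\<close>

lemma strongly_attaining_if_localized:
  fixes A :: "'a::banach set"
  assumes sphere: "A \<subseteq> sphere 0 1" and "closed A"
    and dense: "closure (absolutely_convex_hull A) = cball 0 1"
    and loc: "\<And>e. e > 0 \<Longrightarrow> maximizers_localized U A e"
  shows "attains_strongly_norm_on U A"
proof -
  note le_norm = norm_apply_le_norm[OF sphere]
  have small: "\<exists>s>0. \<forall>y\<in>near_maximizers U A s. \<forall>z\<in>near_maximizers U A s. dist y z < e"
    if e: "e > 0" for e
  proof -
    obtain s x where s: "s > 0" "near_maximizers U A s \<subseteq> ball x (e / 2)"
      using loc[OF half_gt_zero[OF e]] unfolding maximizers_localized_def by blast
    have "dist y z < e" if "y \<in> near_maximizers U A s" "z \<in> near_maximizers U A s" for y z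
    proof (rule dist_triangle_half_r)
      show "dist x y < e / 2" "dist x z < e / 2"
        using that s(2) by (auto simp: subset_iff)
    qed
    with s(1) show ?thesis by blast
  qed
  have "\<exists>z. z \<in> near_maximizers U A (1 / Suc n)" for n
    using near_maximizers_nonempty[OF dense, of "1 / Suc n" U] by auto
  then obtain z where z: "\<And>n. z n \<in> near_maximizers U A (1 / Suc n)"
    by metis
  have zA: "z n \<in> A" for n
    using z by (simp add: near_maximizers_def)
  have "Cauchy z"
    unfolding Cauchy_def
  proof (intro allI impI)
    fix e :: real assume "e > 0"
    then obtain s where s: "s > 0"
      "\<And>y y'. y \<in> near_maximizers U A s \<Longrightarrow> y' \<in> near_maximizers U A s \<Longrightarrow> dist y y' < e"
      using small by blast
    obtain N :: nat where N: "1 / Suc N < s"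
      using nat_approx_posE[OF s(1)] by blast
    have "z n \<in> near_maximizers U A s" if "n \<ge> N" for n
    proof -
      have "1 / real (Suc n) \<le> 1 / real (Suc N)"
        using that by (simp add: frac_le)
      with N z[of n] show ?thesis
        by (simp add: near_maximizers_def)
    qed
    then show "\<exists>N. \<forall>m\<ge>N. \<forall>n\<ge>N. dist (z m) (z n) < e"
      using s(2) by blast
  qed
  then obtain x0 where x0: "z \<longlonglongrightarrow> x0"
    using Cauchy_convergent_iff convergent_def by blast
  then have "x0 \<in> A"
    using closed_sequentially[OF \<open>closed A\<close>] zA by blast
  have "(\<lambda>n. norm (U (z n))) \<longlonglongrightarrow> norm (U x0)"
    using x0 by (intro tendsto_intros)
  moreover have "(\<lambda>n. norm (blinfun_apply U (z n))) \<longlonglongrightarrow> norm U"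
  proof (rule real_tendsto_sandwich)
    show "(\<lambda>n. norm U - 1 / real (Suc n)) \<longlonglongrightarrow> norm U"
      using tendsto_diff[OF tendsto_const LIMSEQ_inverse_real_of_nat, of "norm U"]
      by (simp add: inverse_eq_divide)
    show "\<forall>\<^sub>F n in sequentially. norm U - 1 / real (Suc n) \<le> norm (blinfun_apply U (z n))"
      using z by (intro always_eventually allI less_imp_le) (simp add: near_maximizers_def)
    show "\<forall>\<^sub>F n in sequentially. norm (blinfun_apply U (z n)) \<le> norm U"
      using le_norm zA by (intro always_eventually allI) blast
  qed simp
  ultimately have max: "norm (U x0) = norm U"
    using LIMSEQ_unique by blast
  have "(\<lambda>n. norm (x n - x0)) \<longlonglongrightarrow> 0"
    if xA: "\<And>n. x n \<in> A" and lim: "(\<lambda>n. norm (blinfun_apply U (x n))) \<longlonglongrightarrow> norm (U x0)" for x :: "nat \<Rightarrow> 'a"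
  proof -
    have "x \<longlonglongrightarrow> x0"
    proof (rule tendstoI)
      fix e :: real assume "e > 0"
      then obtain s where s: "s > 0"
        "\<And>y y'. y \<in> near_maximizers U A s \<Longrightarrow> y' \<in> near_maximizers U A s \<Longrightarrow> dist y y' < e"
        using small by blast
      have "x0 \<in> near_maximizers U A s"
        using \<open>x0 \<in> A\<close> max s(1) by (simp add: near_maximizers_def)
      moreover have "\<forall>\<^sub>F n in sequentially. norm U - s < norm (U (x n))"
        using order_tendstoD(1)[OF lim] max s(1) by simp
      ultimately show "\<forall>\<^sub>F n in sequentially. dist (x n) x0 < e"
        using xA s(2) by (auto elim!: eventually_mono simp: near_maximizers_def)
    qed
    then show ?thesis
      using LIM_zero tendsto_norm_zero by blast
  qed
  then show ?thesis
    unfolding attains_strongly_norm_on_def norm_eq_SUP_norming[OF sphere dense, symmetric]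
    using \<open>x0 \<in> A\<close> max by blast
qed

section \<open>The rank one bump and porosity\<close>

text \<open>The direction \<open>w\<close> of the bump is that of \<open>U x\<close>, so that nothing is lost in the triangle
  inequality at \<open>x\<close>, whereas elsewhere at most \<open>\<rho> \<bar>f z\<bar>\<close> is gained.\<close>

lemma rank_one_bump:
  fixes U :: "'a::real_normed_vector \<Rightarrow>\<^sub>L 'b::real_normed_vector" and f :: "'a \<Rightarrow>\<^sub>L real"
  assumes sphere: "A \<subseteq> sphere 0 1" and "x \<in> A" and nz: "\<exists>w :: 'b. w \<noteq> 0"
    and f: "norm f \<le> 1"
      "\<And>z. z \<in> A \<Longrightarrow> norm (z - x) \<ge> \<epsilon> \<Longrightarrow> blinfun_apply f x - \<omega> \<ge> \<bar>blinfun_apply f z\<bar>"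
    and "\<rho> \<ge> 0" and almost: "norm U - \<alpha> \<le> norm (blinfun_apply U x)"
  obtains K where "K \<in> finite_rank_ops" "norm K \<le> \<rho>"
    "near_maximizers (U + K) A (\<rho> * \<omega> - \<alpha>) \<subseteq> ball x \<epsilon>"
proof -
  obtain w :: 'b where w: "norm w = 1" "U x = norm (U x) *\<^sub>R w"
  proof (cases "U x = 0")
    case True
    from nz obtain v :: 'b where "v \<noteq> 0" by blast
    with True that[of "v /\<^sub>R norm v"] show ?thesis by simp
  next
    case False
    with that[of "U x /\<^sub>R norm (U x)"] show ?thesis by simp
  qed
  define K where "K = \<rho> *\<^sub>R (blinfun_scaleR_left w o\<^sub>L f)"
  have K: "K z = (\<rho> * f z) *\<^sub>R w" for z
    by (simp add: K_def blinfun.scaleR_left)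
  have "range (blinfun_apply K) \<subseteq> span {w}"
    by (auto simp: K span_singleton)
  then have "K \<in> finite_rank_ops"
    unfolding finite_rank_ops_def by blast
  moreover have "norm K \<le> \<rho>"
  proof (rule norm_blinfun_bound[OF \<open>\<rho> \<ge> 0\<close>])
    fix z
    have "\<bar>f z\<bar> \<le> 1 * norm z"
      using norm_blinfun[of f z] mult_right_mono[OF f(1) norm_ge_zero[of z]] by simp
    then show "norm (K z) \<le> \<rho> * norm z"
      using \<open>\<rho> \<ge> 0\<close> w(1) by (simp add: K abs_mult mult_left_mono)
  qed
  moreover have "near_maximizers (U + K) A (\<rho> * \<omega> - \<alpha>) \<subseteq> ball x \<epsilon>"
  proof (rule subsetI, rule ccontr)
    fix z assume z: "z \<in> near_maximizers (U + K) A (\<rho> * \<omega> - \<alpha>)" "z \<notin> ball x \<epsilon>"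
    then have "z \<in> A" by (simp add: near_maximizers_def)
    have far: "\<bar>f z\<bar> \<le> f x - \<omega>"
      using f(2)[OF \<open>z \<in> A\<close>] z(2) by (simp add: dist_norm norm_minus_commute)
    have "norm ((U + K) z) \<le> norm (U z) + norm (K z)"
      by (simp add: blinfun.add_left norm_triangle_ineq)
    also have "norm (K z) = \<rho> * \<bar>f z\<bar>"
      using w(1) \<open>\<rho> \<ge> 0\<close> by (simp add: K abs_mult)
    also have "norm (U z) + \<rho> * \<bar>f z\<bar> \<le> norm U + \<rho> * (f x - \<omega>)"
      using norm_apply_le_norm[OF sphere \<open>z \<in> A\<close>] far \<open>\<rho> \<ge> 0\<close>
      by (intro add_mono mult_left_mono) auto
    finally have upper: "norm ((U + K) z) \<le> norm U + \<rho> * f x - \<rho> * \<omega>"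
      by (simp add: algebra_simps)
    have "(U + K) x = (norm (U x) + \<rho> * f x) *\<^sub>R w"
      using w(2) by (simp add: blinfun.add_left K scaleR_add_left)
    then have "norm ((U + K) x) = \<bar>norm (U x) + \<rho> * f x\<bar>"
      using w(1) by simp
    then have "norm U - \<alpha> + \<rho> * f x \<le> norm (U + K)"
      using norm_apply_le_norm[OF sphere \<open>x \<in> A\<close>, of "U + K"] almost by linarith
    with upper z(1) show False
      by (simp add: near_maximizers_def)
  qed
  ultimately show thesis using that by blast
qed

text \<open>Around \<open>T\<close> and at radius \<open>r\<close> the hole is centred at \<open>T + K\<close> with a bump of size \<open>r / 2\<close>. The
  other half of \<open>r\<close> keeps the hole inside the ball, and the localization tolerance, about
  \<open>r \<omega> / 2\<close>, exceeds twice the radius of the hole.\<close>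

lemma porous_not_localized:
  fixes S :: "'a::real_normed_vector \<Rightarrow>\<^sub>L 'b::real_normed_vector"
  assumes sphere: "A \<subseteq> sphere 0 1"
    and dense: "closure (absolutely_convex_hull A) = cball 0 1"
    and nz: "\<exists>w :: 'b. w \<noteq> 0"
    and sub: "subspace \<A>" "finite_rank_ops \<subseteq> \<A>"
    and "\<omega> > 0"
    and exposed: "\<And>x. x \<in> A \<Longrightarrow> \<exists>f :: 'a \<Rightarrow>\<^sub>L real. norm f \<le> 1 \<and>
             (\<forall>z\<in>A. norm (z - x) \<ge> \<epsilon> \<longrightarrow>
                blinfun_apply f x - \<omega> \<ge> \<bar>blinfun_apply f z\<bar>)"
  shows "porous_in \<A> {T \<in> \<A>. \<not> maximizers_localized (S + T) A \<epsilon>}"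
proof -
  define l where "l = min (1 / 2) (\<omega> / 8)"
  have l: "0 < l" "l \<le> 1 / 2" "l \<le> \<omega> / 8"
    using \<open>\<omega> > 0\<close> by (auto simp: l_def)
  have "\<exists>y\<in>\<A>. ball y (l * r) \<inter> \<A> \<subseteq>
      (ball T r \<inter> \<A>) \<inter> (\<A> - {T \<in> \<A>. \<not> maximizers_localized (S + T) A \<epsilon>})"
    if T: "T \<in> \<A>" and r: "0 < r" for T r
  proof -
    obtain x where "x \<in> near_maximizers (S + T) A (r * \<omega> / 16)"
      using near_maximizers_nonempty[OF dense, of "r * \<omega> / 16" "S + T"] \<open>\<omega> > 0\<close> r by auto
    then have x: "x \<in> A" "norm (S + T) - r * \<omega> / 16 \<le> norm ((S + T) x)"
      by (auto simp: near_maximizers_def)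
    obtain f :: "'a \<Rightarrow>\<^sub>L real" where "norm f \<le> 1"
      "\<And>z. z \<in> A \<Longrightarrow> norm (z - x) \<ge> \<epsilon> \<Longrightarrow> f x - \<omega> \<ge> \<bar>f z\<bar>"
      using exposed[OF x(1)] by blast
    from rank_one_bump[OF sphere x(1) nz this _ x(2), where \<rho> = "r / 2"] r
    obtain K where K: "K \<in> finite_rank_ops" "norm K \<le> r / 2"
      "near_maximizers (S + T + K) A (r / 2 * \<omega> - r * \<omega> / 16) \<subseteq> ball x \<epsilon>"
      by auto
    have "V \<in> ball T r \<and> maximizers_localized (S + V) A \<epsilon>" if V: "V \<in> ball (T + K) (l * r)" for V
    proof
      have d: "norm (V - (T + K)) < l * r"
        using V by (simp add: dist_norm norm_minus_commute)
      have lr: "l * r \<le> r / 2" "l * r \<le> \<omega> * r / 8"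
        using l r mult_right_mono[of l _ r] by auto
      have "norm (V - T) \<le> norm (V - (T + K)) + norm K"
        using norm_triangle_ineq[of "V - (T + K)" K] by simp
      then show "V \<in> ball T r"
        using d lr K(2) by (simp add: dist_norm norm_minus_commute)
      have "norm (S + V - (S + T + K)) < l * r"
        using d by (simp add: algebra_simps)
      then have "r * \<omega> / 16 + 2 * norm (S + V - (S + T + K)) \<le> r / 2 * \<omega> - r * \<omega> / 16"
        using lr(2) mult_pos_pos[OF r \<open>\<omega> > 0\<close>] mult.commute[of \<omega> r] by linarith
      then have "near_maximizers (S + V) A (r * \<omega> / 16)
          \<subseteq> near_maximizers (S + T + K) A (r / 2 * \<omega> - r * \<omega> / 16)"
        by (rule near_maximizers_stable[OF sphere])
      with K(3) have "near_maximizers (S + V) A (r * \<omega> / 16) \<subseteq> ball x \<epsilon>" by blast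
      then show "maximizers_localized (S + V) A \<epsilon>"
        unfolding maximizers_localized_def using r \<open>\<omega> > 0\<close>
        by (intro exI[of _ "r * \<omega> / 16"]) auto
    qed
    moreover have "T + K \<in> \<A>"
      using T K(1) sub by (auto intro: subspace_add)
    ultimately show ?thesis by (intro bexI[of _ "T + K"]) auto
  qed
  then show ?thesis
    unfolding porous_in_def using l
    by (intro conjI exI[of _ l] exI[of _ "1::real"]) auto
qed

section \<open>Strong norm attainment\<close>

text \<open>Since \<open>\<parallel>T\<parallel> = 1\<close>, the vector \<open>V\<close> is no farther from its own normalization than from \<open>T\<close>.\<close>

lemma normalization_distance:
  fixes T V :: "'a::real_normed_vector"
  assumes "norm T = 1" "V \<noteq> 0"
  shows "norm (V /\<^sub>R norm V - T) \<le> 2 * norm (V - T)"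
proof -
  have "norm (V /\<^sub>R norm V - V) = \<bar>norm V - 1\<bar>"
  proof -
    have "V /\<^sub>R norm V - V = (1 - norm V) *\<^sub>R (V /\<^sub>R norm V)"
      using assms(2) by (simp add: scaleR_diff_left left_diff_distrib)
    then show ?thesis
      using assms(2) by (simp only: norm_scaleR) (simp add: abs_minus_commute)
  qed
  also have "\<dots> \<le> norm (V - T)"
    using norm_triangle_ineq3[of V T] assms(1) by simp
  finally show ?thesis
    using norm_triangle_ineq[of "V /\<^sub>R norm V - V" "V - T"] by simp
qed

lemma sigma_porous_not_strongly_attaining:
  fixes A :: "'x::banach set" and S :: "'x \<Rightarrow>\<^sub>L 'w::real_normed_vector"
  assumes sphere: "A \<subseteq> sphere 0 1" and clA: "closed A"
    and dense: "closure (absolutely_convex_hull A) = cball 0 1"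
    and "\<epsilon>0 > 0"
    and exposed: "\<And>\<epsilon>. 0 < \<epsilon> \<Longrightarrow> \<epsilon> < \<epsilon>0 \<Longrightarrow>
          (\<exists>\<omega>>0. \<forall>x\<in>A. \<exists>f :: 'x \<Rightarrow>\<^sub>L real. norm f \<le> 1 \<and>
             (\<forall>z\<in>A. norm (z - x) \<ge> \<epsilon> \<longrightarrow>
                blinfun_apply f x - \<omega> \<ge> \<bar>blinfun_apply f z\<bar>))"
    and nz: "\<exists>w :: 'w. w \<noteq> 0"
    and sub: "subspace \<A>" "finite_rank_ops \<subseteq> \<A>"
  shows "sigma_porous_in \<A> (\<A> - {T \<in> \<A>. attains_strongly_norm_on (S + T) A})"
    (is "sigma_porous_in \<A> ?B")
proof -
  define e where "e n = \<epsilon>0 / (real n + 2)" for n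
  have e: "0 < e n" "e n < \<epsilon>0" for n
    using \<open>\<epsilon>0 > 0\<close> by (auto simp: e_def divide_less_eq)
  \<comment> \<open>The intersection with the exceptional set makes the union of the \<open>Q n\<close> exactly that set, so
    that only one implication between localization and strong attainment has to be proved.\<close>
  define Q where "Q n = ?B \<inter> {T \<in> \<A>. \<not> maximizers_localized (S + T) A (e n)}" for n
  have "porous_in \<A> (Q n)" for n
  proof -
    obtain \<omega> where "\<omega> > 0" "\<And>x. x \<in> A \<Longrightarrow> \<exists>f :: 'x \<Rightarrow>\<^sub>L real. norm f \<le> 1 \<and>
        (\<forall>z\<in>A. norm (z - x) \<ge> e n \<longrightarrow> blinfun_apply f x - \<omega> \<ge> \<bar>blinfun_apply f z\<bar>)"
      using exposed[OF e] by blast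
    then have "porous_in \<A> {T \<in> \<A>. \<not> maximizers_localized (S + T) A (e n)}"
      by (intro porous_not_localized[OF sphere dense nz sub])
    then show ?thesis
      unfolding Q_def by (rule porous_in_subset) (rule Int_lower2)
  qed
  moreover have "?B = (\<Union>n. Q n)"
  proof (rule antisym)
    show "?B \<subseteq> (\<Union>n. Q n)"
    proof
      fix T assume T: "T \<in> ?B"
      then have "\<not> attains_strongly_norm_on (S + T) A" by simp
      then obtain d where d: "d > 0" "\<not> maximizers_localized (S + T) A d"
        using strongly_attaining_if_localized[OF sphere clA dense] by blast
      obtain n :: nat where "\<epsilon>0 / d < n"
        using reals_Archimedean2 by blast
      then have "e n < d"
        using d(1) by (simp add: e_def divide_less_eq algebra_simps)
      with d(2) have "\<not> maximizers_localized (S + T) A (e n)"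
        using maximizers_localized_mono less_imp_le by blast
      with T show "T \<in> (\<Union>n. Q n)"
        by (auto simp: Q_def)
    qed
  qed (auto simp: Q_def)
  ultimately show ?thesis
    unfolding sigma_porous_in_def by blast
qed

theorem corollary3:
  fixes A :: "'x::banach set"
    and \<A> :: "('x \<Rightarrow>\<^sub>L 'w::banach) set"
  assumes A_sphere: "A \<subseteq> sphere 0 1"
    and A_closed: "closed A"
    and A_dense: "closure (absolutely_convex_hull A) = cball 0 1"
    and A_exposed: "\<exists>\<epsilon>0>0. \<forall>\<epsilon>. 0 < \<epsilon> \<and> \<epsilon> < \<epsilon>0 \<longrightarrow>
          (\<exists>\<omega>>0. \<forall>x\<in>A. \<exists>f :: 'x \<Rightarrow>\<^sub>L real. norm f \<le> 1 \<and>
             (\<forall>z\<in>A. norm (z - x) \<ge> \<epsilon> \<longrightarrow>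
                blinfun_apply f x - \<omega> \<ge> \<bar>blinfun_apply f z\<bar>))"
    and W_nonzero: "\<exists>w :: 'w. w \<noteq> 0"
    and \<A>_subspace: "subspace \<A>"
    and \<A>_closed: "closed \<A>"
    and \<A>_finite_rank: "finite_rank_ops \<subseteq> \<A>"
  shows "(\<forall>S :: 'x \<Rightarrow>\<^sub>L 'w.
            sigma_porous_in \<A> (\<A> - {T \<in> \<A>. attains_strongly_norm_on (S + T) A}))
       \<and> (\<forall>\<epsilon>>0. \<exists>\<eta>>0. \<forall>T\<in>\<A>. \<forall>x\<in>A.
            norm T = 1 \<and> norm (blinfun_apply T x) > 1 - \<eta> \<longrightarrow>
            (\<exists>S\<in>\<A>. \<exists>z\<in>A. norm S = 1 \<and> norm (blinfun_apply S z) = 1 \<and>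
               norm (x - z) < \<epsilon> \<and> norm (S - T) < \<epsilon>))"
proof -
  obtain \<epsilon>0 where "\<epsilon>0 > 0" and exposed: "\<And>\<epsilon>. 0 < \<epsilon> \<Longrightarrow> \<epsilon> < \<epsilon>0 \<Longrightarrow>
          (\<exists>\<omega>>0. \<forall>x\<in>A. \<exists>f :: 'x \<Rightarrow>\<^sub>L real. norm f \<le> 1 \<and>
             (\<forall>z\<in>A. norm (z - x) \<ge> \<epsilon> \<longrightarrow>
                blinfun_apply f x - \<omega> \<ge> \<bar>blinfun_apply f z\<bar>))"
    using A_exposed by blast
  have porous: "sigma_porous_in \<A> (\<A> - {T \<in> \<A>. attains_strongly_norm_on (S + T) A})"
    for S :: "'x \<Rightarrow>\<^sub>L 'w"
    using sigma_porous_not_strongly_attaining[OF A_sphere A_closed A_dense \<open>\<epsilon>0 > 0\<close> exposed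
        W_nonzero \<A>_subspace \<A>_finite_rank] .
  have attaining_dense: "\<A> \<subseteq> closure {T \<in> \<A>. attains_strongly_norm_on T A}"
    using sigma_porous_in_codense[OF \<A>_closed porous[of 0]]
    by (simp add: double_diff Collect_conj_eq)
  have "\<exists>\<eta>>0. \<forall>T\<in>\<A>. \<forall>x\<in>A. norm T = 1 \<and> norm (blinfun_apply T x) > 1 - \<eta> \<longrightarrow>
      (\<exists>S\<in>\<A>. \<exists>z\<in>A. norm S = 1 \<and> norm (blinfun_apply S z) = 1 \<and>
         norm (x - z) < \<epsilon> \<and> norm (S - T) < \<epsilon>)" if "\<epsilon> > 0" for \<epsilon>
  proof -
    define \<delta> where "\<delta> = min \<epsilon> (\<epsilon>0 / 2)"
    have "0 < \<delta>" "\<delta> < \<epsilon>0" "\<delta> \<le> \<epsilon>"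
      using \<open>\<epsilon> > 0\<close> \<open>\<epsilon>0 > 0\<close> by (auto simp: \<delta>_def)
    then obtain \<omega> where "\<omega> > 0" and f: "\<And>x. x \<in> A \<Longrightarrow> \<exists>f :: 'x \<Rightarrow>\<^sub>L real. norm f \<le> 1 \<and>
        (\<forall>z\<in>A. norm (z - x) \<ge> \<delta> \<longrightarrow> blinfun_apply f x - \<omega> \<ge> \<bar>blinfun_apply f z\<bar>)"
      using exposed by blast
    \<comment> \<open>The bump and the passage to a strongly attaining operator each move \<open>T\<close> by at most \<open>\<rho>\<close>, and
      normalization at most doubles the distance, so that \<open>4 * \<rho> < \<epsilon>\<close> is what is needed.\<close>
    define \<rho> where "\<rho> = min \<epsilon> 1 / 8"
    have \<rho>: "\<rho> > 0" "8 * \<rho> \<le> \<epsilon>" "8 * \<rho> \<le> 1"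
      using \<open>\<epsilon> > 0\<close> by (auto simp: \<rho>_def)
    \<comment> \<open>A deficit of \<open>\<rho> * \<omega> / 2\<close> at \<open>x\<close> leaves half of the gap \<open>\<rho> * \<omega>\<close> created by the bump.\<close>
    show ?thesis
    proof (intro exI[of _ "\<rho> * \<omega> / 2"] conjI ballI impI)
      show "\<rho> * \<omega> / 2 > 0"
        using \<rho>(1) \<open>\<omega> > 0\<close> by simp
      fix T x assume T: "T \<in> \<A>" and x: "x \<in> A"
        and Tx: "norm T = 1 \<and> norm (blinfun_apply T x) > 1 - \<rho> * \<omega> / 2"
      obtain f :: "'x \<Rightarrow>\<^sub>L real" where "norm f \<le> 1"
        "\<And>z. z \<in> A \<Longrightarrow> norm (z - x) \<ge> \<delta> \<Longrightarrow> f x - \<omega> \<ge> \<bar>f z\<bar>"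
        using f[OF x] by blast
      from rank_one_bump[OF A_sphere x W_nonzero this, where \<rho> = \<rho> and U = T
          and \<alpha> = "\<rho> * \<omega> / 2"] Tx \<rho>(1)
      obtain K where K: "K \<in> finite_rank_ops" "norm K \<le> \<rho>"
        "near_maximizers (T + K) A (\<rho> * \<omega> - \<rho> * \<omega> / 2) \<subseteq> ball x \<delta>"
        by auto
      have "T + K \<in> \<A>"
        using T K(1) \<A>_subspace \<A>_finite_rank by (auto intro: subspace_add)
      then have "T + K \<in> closure {T \<in> \<A>. attains_strongly_norm_on T A}"
        using attaining_dense by blast
      moreover have "min \<rho> (\<rho> * \<omega> / 8) > 0"
        using \<rho>(1) \<open>\<omega> > 0\<close> by simp
      ultimately obtain V where V: "V \<in> \<A>" "attains_strongly_norm_on V A"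
        and "dist V (T + K) < min \<rho> (\<rho> * \<omega> / 8)"
        unfolding closure_approachable by blast
      then have d: "norm (V - (T + K)) < \<rho>" "norm (V - (T + K)) < \<rho> * \<omega> / 8"
        by (auto simp: dist_norm)
      from V(2) obtain z where z: "z \<in> A" "norm (V z) = norm V"
        unfolding attains_strongly_norm_on_def by metis
      have "z \<in> near_maximizers V A (\<rho> * \<omega> / 8)"
        using z \<rho>(1) \<open>\<omega> > 0\<close> by (simp add: near_maximizers_def)
      moreover have "near_maximizers V A (\<rho> * \<omega> / 8)
          \<subseteq> near_maximizers (T + K) A (\<rho> * \<omega> - \<rho> * \<omega> / 2)"
        using d(2) \<rho>(1) \<open>\<omega> > 0\<close> mult_pos_pos[of \<rho> \<omega>]
        by (intro near_maximizers_stable[OF A_sphere]) linarith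
      ultimately have "norm (x - z) < \<epsilon>"
        using K(3) \<open>\<delta> \<le> \<epsilon>\<close> by (auto simp: dist_norm)
      have "norm (V - T) \<le> norm (V - (T + K)) + norm K"
        using norm_triangle_ineq[of "V - (T + K)" K] by simp
      with d(1) K(2) have VT: "norm (V - T) < 2 * \<rho>" by linarith
      have "V \<noteq> 0"
        using VT Tx \<rho>(3) by auto
      define R where "R = V /\<^sub>R norm V"
      have "norm (R - T) < \<epsilon>"
        using normalization_distance[OF _ \<open>V \<noteq> 0\<close>, of T] Tx VT \<rho> by (simp add: R_def)
      moreover have "R \<in> \<A>"
        using V(1) \<A>_subspace by (simp add: R_def subspace_scale)
      moreover have "norm R = 1" "norm (R z) = 1"
        using \<open>V \<noteq> 0\<close> z(2) by (auto simp: R_def blinfun.scaleR_left)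
      ultimately show "\<exists>S\<in>\<A>. \<exists>z\<in>A. norm S = 1 \<and> norm (blinfun_apply S z) = 1 \<and>
          norm (x - z) < \<epsilon> \<and> norm (S - T) < \<epsilon>"
        using z(1) \<open>norm (x - z) < \<epsilon>\<close> by blast
    qed
  qed
  with porous show ?thesis by blast
qed

end
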